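(* Let $r\ge 3$ be an integer such that $r-2$ is a prime power. Then there exists a constant $C=C(r)$, depending only on $r$, such that for all sufficiently large $n$ the $r$-color size Ramsey number $\hat{R}(P_n,r)$ satisfies $$\hat{R}(P_n,r)>(r-2)^2n-C\sqrt{n}.$$
   Context: $P_n$ is the path on $n$ vertices. For graphs $G,H$ and a positive integer $r$, write $G\rightarrow (H)_r$ if every $r$-coloring of the edges of $G$ produces a monochromatic copy of $H$ (as a not necessarily induced subgraph). The $r$-color size Ramsey number $\hat{R}(H,r)$ is the minimum possible number of edges in a graph $G$ for which $G\rightarrow (H)_r$. *)

theory Defs
  imports
    "HOL-Analysis.Analysis"
    "HOL-Library.Ramsey"
    "HOL-Number_Theory.Number_Theory"
begin

text \<open>A graph is a pair of a vertex set and a set of edges, each edge being a two-element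
  set of vertices.\<close>

type_synonym 'a graph = "'a set \<times> 'a set set"

abbreviation verts :: "'a graph \<Rightarrow> 'a set" where
  "verts G \<equiv> fst G"

abbreviation edges :: "'a graph \<Rightarrow> 'a set set" where
  "edges G \<equiv> snd G"

definition finite_simple_graph :: "'a graph \<Rightarrow> bool" where
  "finite_simple_graph G \<longleftrightarrow> finite (verts G) \<and> edges G \<subseteq> [verts G]\<^bsup>2\<^esup>"

definition path_graph :: "nat \<Rightarrow> nat graph" where
  "path_graph n = ({..<n}, {{i, Suc i} | i. Suc i < n})"

definition contains_copy :: "'a graph \<Rightarrow> 'b graph \<Rightarrow> bool" where
  "contains_copy G H \<longleftrightarrow>
     (\<exists>f. inj_on f (verts H) \<and> f ` verts H \<subseteq> verts G \<and> (\<forall>e\<in>edges H. f ` e \<in> edges G))"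

definition colour_class :: "'a graph \<Rightarrow> ('a set \<Rightarrow> nat) \<Rightarrow> nat \<Rightarrow> 'a graph" where
  "colour_class G c i = (verts G, {e \<in> edges G. c e = i})"

definition arrows :: "'a graph \<Rightarrow> 'b graph \<Rightarrow> nat \<Rightarrow> bool" where
  "arrows G H r \<longleftrightarrow>
     (\<forall>c \<in> edges G \<rightarrow> {..<r}. \<exists>i<r. contains_copy (colour_class G c i) H)"

text \<open>Every finite graph is isomorphic to one whose vertices are natural numbers, so restricting
  the host graph to vertex type \<^typ>\<open>nat\<close> loses nothing. The minimum is attained by the lemma
  \<open>ex_arrows\<close> below.\<close>

definition size_ramsey :: "'b graph \<Rightarrow> nat \<Rightarrow> nat" where
  "size_ramsey H r =
     (LEAST m. \<exists>G :: nat graph. finite_simple_graph G \<and> arrows G H r \<and> card (edges G) = m)"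

lemma finite_simple_path_graph: "finite_simple_graph (path_graph n)"
  by (auto simp: finite_simple_graph_def path_graph_def nsets_def)

lemma ex_arrows:
  assumes H: "finite_simple_graph H"
  shows "\<exists>G :: nat graph. finite_simple_graph G \<and> arrows G H r"
proof -
  obtain N :: nat where N: "partn_lst {..<N} (replicate r (card (verts H))) 2"
    using ramsey_full by blast
  define G :: "nat graph" where "G = ({..<N}, [{..<N}]\<^bsup>2\<^esup>)"
  have copy: "contains_copy (colour_class G c i) H"
    if S: "S \<in> [{..<N}]\<^bsup>(card (verts H))\<^esup>" and c: "c ` [S]\<^bsup>2\<^esup> \<subseteq> {i}" for c i S
  proof -
    have fin: "finite (verts H)" "finite S" "card S = card (verts H)" and SN: "S \<subseteq> {..<N}"
      using H S by (auto simp: finite_simple_graph_def nsets_def)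
    then obtain f where f: "bij_betw f (verts H) S"
      by (metis finite_same_card_bij)
    have "f ` e \<in> [S]\<^bsup>2\<^esup>" if "e \<in> edges H" for e
    proof -
      have e: "e \<subseteq> verts H" "card e = 2" "finite e"
        using that H by (auto simp: finite_simple_graph_def nsets_def)
      then have "card (f ` e) = 2"
        using f by (metis bij_betw_imp_inj_on card_image inj_on_subset)
      then show ?thesis
        using e f by (auto simp: nsets_def bij_betw_def)
    qed
    moreover have "[S]\<^bsup>2\<^esup> \<subseteq> [{..<N}]\<^bsup>2\<^esup>"
      using SN by (rule nsets_mono)
    ultimately have "f ` e \<in> [{..<N}]\<^bsup>2\<^esup> \<and> c (f ` e) = i" if "e \<in> edges H" for e
      using that c by blast
    then show ?thesis
      unfolding contains_copy_def colour_class_def G_def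
      using f SN by (intro exI[of _ f]) (auto simp: bij_betw_def)
  qed
  have "arrows G H r"
    unfolding arrows_def
  proof
    fix c assume "c \<in> edges G \<rightarrow> {..<r}"
    then have "c \<in> [{..<N}]\<^bsup>2\<^esup> \<rightarrow> {..<length (replicate r (card (verts H)))}"
      by (simp add: G_def)
    then obtain i S where i: "i < length (replicate r (card (verts H)))"
      and S: "S \<in> [{..<N}]\<^bsup>(replicate r (card (verts H)) ! i)\<^esup>" and c: "c ` [S]\<^bsup>2\<^esup> \<subseteq> {i}"
      using N unfolding partn_lst_def monochromatic_def by blast
    then have "i < r" and "S \<in> [{..<N}]\<^bsup>(card (verts H))\<^esup>"
      by simp_all
    with c copy show "\<exists>i<r. contains_copy (colour_class G c i) H"
      by blast
  qed
  moreover have "finite_simple_graph G"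
    by (simp add: G_def finite_simple_graph_def)
  ultimately show ?thesis by blast
qed

end

theory Submission
  imports Defs "HOL-Algebra.Algebraic_Closure"
begin

text \<open>
  Put \<open>q = r - 2\<close> and take an affine plane of order \<open>q\<close>: it has \<open>q\<^sup>2\<close> points, and its lines, with
  \<open>q\<close> points each, fall into \<open>q + 1 = r - 1\<close> parallel classes. Place the vertices of a graph \<open>G\<close> on
  the points by some map \<open>f\<close>, and give an edge \<open>{u, v}\<close> the number of a parallel class having a
  line through both \<open>f u\<close> and \<open>f v\<close>. Lines of one class are disjoint, so the vertices of a path
  in one of these \<open>r - 1\<close> colours are all placed on a single line (\<open>affine_colouring\<close>). Hence such a
  path on \<open>n\<close> vertices needs a line whose preimage spans at least \<open>n - 1\<close> edges.

  For a uniformly random \<open>f\<close>, both ends of an edge are placed on a given line with probability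
  \<open>1 / q\<^sup>2\<close>, so a line receives \<open>m / q\<^sup>2\<close> of the \<open>m\<close> edges on average. Edges without a common
  vertex are independent; when all degrees are at most \<open>D\<close>, only \<open>O(D m)\<close> pairs of edges contribute
  to the variance, and summing the squared deviations over the boundedly many lines shows that for
  some \<open>f\<close> every line receives at most \<open>m / q\<^sup>2 + O(\<surd>m)\<close> edges (\<open>ex_balanced_map\<close>). If
  \<open>m \<le> q\<^sup>2 n - C \<surd>n\<close> with \<open>C\<close> large, this is below \<open>n - 1\<close>.

  The last of the \<open>r\<close> colours takes care of the degree condition: it is given to all edges that meet
  the set \<open>H\<close> of vertices of degree at least \<open>6 q\<^sup>2\<close>. When \<open>m < q\<^sup>2 n\<close>, there are fewer than
  \<open>n div 2\<close> such vertices, and a path on \<open>n\<close> vertices has no vertex cover that small.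

  The plane is the coordinate plane over a field with \<open>q\<close> elements, which is found as the set of
  roots of \<open>X\<^sup>q - X\<close> in an algebraic closure of \<open>\<int>/p\<close>, where \<open>q\<close> is a
  power of the prime \<open>p\<close>. For \<open>q = 1\<close> a single point does.
\<close>

section \<open>Finite fields of prime power order\<close>

lemma (in cring) binomial_expansion:
  assumes x: "x \<in> carrier R" and y: "y \<in> carrier R"
  shows "(x \<oplus> y) [^] (n::nat)
           = (\<Oplus>k\<in>{..n}. add_pow R (n choose k) (x [^] k \<otimes> y [^] (n - k)))"
proof (induction n)
  case 0
  show ?case using x y by simp
next
  case (Suc n)
  define T where "T k = add_pow R (n choose k) (x [^] k \<otimes> y [^] (n - k))" for k
  define A where "A k = add_pow R (n choose (k - 1)) (x [^] k \<otimes> y [^] (Suc n - k))" for k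
  define B where "B k = add_pow R (n choose k) (x [^] k \<otimes> y [^] (Suc n - k))" for k
  have cl: "T \<in> S \<rightarrow> carrier R" "A \<in> S \<rightarrow> carrier R" "B \<in> S \<rightarrow> carrier R"
    "(\<lambda>k. A (Suc k)) \<in> S \<rightarrow> carrier R" for S
    using x y by (auto simp: T_def A_def B_def)
  have Tx: "T k \<otimes> x = A (Suc k)" for k
    using x y add_pow_ldistr[of "x [^] k \<otimes> y [^] (n - k)" x "n choose k"]
    by (simp add: T_def A_def m_ac)
  have Ty: "T k \<otimes> y = B k" if "k \<le> n" for k
    using x y that add_pow_ldistr[of "x [^] k \<otimes> y [^] (n - k)" y "n choose k"]
    by (simp add: T_def B_def m_assoc Suc_diff_le)
  have "(x \<oplus> y) [^] Suc n = (\<Oplus>k\<in>{..n}. T k) \<otimes> (x \<oplus> y)"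
    using Suc by (simp add: T_def)
  also have "\<dots> = (\<Oplus>k\<in>{..n}. T k) \<otimes> x \<oplus> (\<Oplus>k\<in>{..n}. T k) \<otimes> y"
    using x y cl by (intro r_distr) auto
  also have "(\<Oplus>k\<in>{..n}. T k) \<otimes> x = (\<Oplus>k\<in>{..n}. A (Suc k))"
    using finsum_ldistr[of "{..n}" x T] x cl by (simp add: Tx)
  also have "(\<Oplus>k\<in>{..n}. T k) \<otimes> y = (\<Oplus>k\<in>{..n}. T k \<otimes> y)"
    using finsum_ldistr[of "{..n}" y T] y cl by simp
  also have "\<dots> = (\<Oplus>k\<in>{..n}. B k)"
    by (rule finsum_cong') (use cl(3) Ty in auto)
  also have "\<dots> = (\<Oplus>k\<in>{..n}. B (Suc k)) \<oplus> B 0"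
  proof -
    have "B (Suc n) = \<zero>"
      by (simp add: B_def binomial_eq_0)
    then have "(\<Oplus>k\<in>{..n}. B k) = (\<Oplus>k\<in>{..Suc n}. B k)"
      using cl(3) by (subst finsum_Suc) auto
    also have "\<dots> = (\<Oplus>k\<in>{..n}. B (Suc k)) \<oplus> B 0"
      using cl(3) by (intro finsum_Suc2)
    finally show ?thesis .
  qed
  also have "(\<Oplus>k\<in>{..n}. A (Suc k)) \<oplus> ((\<Oplus>k\<in>{..n}. B (Suc k)) \<oplus> B 0)
               = (\<Oplus>k\<in>{..n}. A (Suc k) \<oplus> B (Suc k)) \<oplus> B 0"
    using cl(4)[of "{..n}"] x y
    by (subst finsum_addf) (auto simp: a_assoc B_def intro!: finsum_closed)
  also have "\<dots> = (\<Oplus>k\<in>{..Suc n}. add_pow R (Suc n choose k) (x [^] k \<otimes> y [^] (Suc n - k)))"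
    using x y add.nat_pow_mult
    by (subst finsum_Suc2) (auto simp: A_def B_def)
  finally show ?case .
qed

text \<open>The binomial coefficients strictly between the ends of row \<open>p\<close> are divisible by \<open>p\<close>, so only the
  two outer terms of the binomial expansion survive.\<close>

lemma (in cring) frobenius_add:
  assumes p: "Factorial_Ring.prime (p::nat)" and char: "add_pow R p \<one> = \<zero>"
    and x: "x \<in> carrier R" and y: "y \<in> carrier R"
  shows "(x \<oplus> y) [^] p = x [^] p \<oplus> y [^] p"
proof -
  have vanish: "add_pow R m z = \<zero>" if "p dvd m" "z \<in> carrier R" for m z
  proof -
    obtain j where m: "m = p * j" using \<open>p dvd m\<close> by (elim dvdE)
    have "add_pow R p z = (add_pow R p \<one>) \<otimes> z"
      using that add_pow_ldistr[of \<one> z p] by simp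
    then have "add_pow R p z = \<zero>" using that char by simp
    then show ?thesis
      using that(2) add.nat_pow_pow[of z j p] by (simp add: m mult.commute)
  qed
  let ?t = "\<lambda>k. add_pow R (p choose k) (x [^] k \<otimes> y [^] (p - k))"
  obtain m where m: "p = Suc m" "m > 0"
    using prime_gt_1_nat[OF p] by (cases p) auto
  have cl: "?t \<in> S \<rightarrow> carrier R" "(\<lambda>k. ?t (Suc k)) \<in> S \<rightarrow> carrier R" for S
    using x y by auto
  have "(x \<oplus> y) [^] p = (\<Oplus>k\<in>{..Suc m}. ?t k)"
    using binomial_expansion[OF x y, of p] m by simp
  also have "\<dots> = (\<Oplus>k\<in>{..m}. ?t (Suc k)) \<oplus> ?t 0"
    using cl(1) by (rule finsum_Suc2)
  also have "(\<Oplus>k\<in>{..m}. ?t (Suc k)) = (\<Oplus>k\<in>{m}. ?t (Suc k))"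
  proof (intro add.finprod_mono_neutral_cong_right ballI)
    fix k assume "k \<in> {..m} - {m}"
    then show "?t (Suc k) = \<zero>"
      using x y m by (intro vanish dvd_choose_prime) (use p in auto)
  qed (use cl in auto)
  also have "\<dots> = x [^] p"
    using x y m cl by (simp del: binomial_Suc_Suc)
  finally show ?thesis using x y m by (simp del: binomial_Suc_Suc)
qed

lemma (in cring) frobenius_power_add:
  assumes p: "Factorial_Ring.prime (p::nat)" and char: "add_pow R p \<one> = \<zero>"
    and x: "x \<in> carrier R" and y: "y \<in> carrier R"
  shows "(x \<oplus> y) [^] (p ^ k) = x [^] (p ^ k) \<oplus> y [^] (p ^ k)"
proof (induction k)
  case (Suc k)
  have "(x \<oplus> y) [^] (p ^ Suc k) = ((x \<oplus> y) [^] (p ^ k)) [^] p"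
    using x y by (simp add: nat_pow_pow mult.commute)
  then show ?case
    using x y Suc frobenius_add[OF p char, of "x [^] (p^k)" "y [^] (p^k)"]
    by (simp add: nat_pow_pow mult.commute)
qed (use x y in simp)

lemma (in cring) frobenius_power_diff:
  assumes p: "Factorial_Ring.prime (p::nat)" and char: "add_pow R p \<one> = \<zero>"
    and x: "x \<in> carrier R" and y: "y \<in> carrier R"
  shows "(x \<ominus> y) [^] (p ^ k) = x [^] (p ^ k) \<ominus> y [^] (p ^ k)"
proof -
  have "x [^] (p ^ k) = ((x \<ominus> y) \<oplus> y) [^] (p ^ k)"
    using x y by (simp add: minus_eq a_assoc l_neg)
  also have "\<dots> = (x \<ominus> y) [^] (p ^ k) \<oplus> y [^] (p ^ k)"
    using x y by (intro frobenius_power_add[OF p char]) auto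
  finally show ?thesis
    using x y by (metis add.inv_solve_right minus_eq minus_closed nat_pow_closed)
qed

lemma (in field) frobenius_fixed_points_subfield:
  assumes p: "Factorial_Ring.prime (p::nat)" and char: "add_pow R p \<one> = \<zero>"
  shows "subfield {x \<in> carrier R. x [^] (p ^ k) = x} R"
proof (rule subfieldI'[OF subringI])
  let ?S = "{x \<in> carrier R. x [^] (p ^ k) = x}"
  have q: "p ^ k \<noteq> 0" using p by (auto simp: prime_gt_0_nat)
  have z: "\<zero> [^] (p ^ k) = \<zero>" using q by (intro nat_pow_zero)
  show "\<ominus> h \<in> ?S" if "h \<in> ?S" for h
    using that frobenius_power_diff[OF p char, of \<zero> h k] z by (simp add: minus_eq)
  show "h1 \<otimes> h2 \<in> ?S" if "h1 \<in> ?S" "h2 \<in> ?S" for h1 h2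
    using that by (simp add: nat_pow_distrib)
  show "h1 \<oplus> h2 \<in> ?S" if "h1 \<in> ?S" "h2 \<in> ?S" for h1 h2
    using that by (simp add: frobenius_power_add[OF p char])
  show "inv h \<in> ?S" if "h \<in> ?S - {\<zero>}" for h
  proof -
    have h: "h \<in> Units R" "h \<in> carrier R" "h [^] (p ^ k) = h"
      using that by (auto simp: field_Units)
    have "inv h [^] (p ^ k) \<otimes> h = (inv h \<otimes> h) [^] (p ^ k)"
      using h by (subst nat_pow_distrib) auto
    then have "inv h [^] (p ^ k) \<otimes> h = \<one>"
      using h by simp
    then show ?thesis
      using h by (auto intro!: inv_unique' simp: m_comm)
  qed
qed auto

text \<open>With \<open>q = p ^ k\<close>, the fixed points are the roots of \<open>f = X\<^sup>q - X\<close>, which splits, so it suffices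
  that every root \<open>a\<close> is simple. As \<open>a\<^sup>q = a\<close>, the Frobenius identity in the polynomial ring gives
  \<open>f = (X - a)\<^sup>q - (X - a)\<close>; if \<open>(X - a)\<^sup>2\<close> divided \<open>f\<close>, it would divide \<open>X - a\<close>.\<close>

lemma (in algebraically_closed) card_frobenius_fixed_points:
  assumes p: "Factorial_Ring.prime (p::nat)" and char: "add_pow L p \<one> = \<zero>" and "k > 0"
  shows "card {x \<in> carrier L. x [^] (p ^ k) = x} = p ^ k"
proof -
  define q where "q = p ^ k"
  have q: "q \<ge> 2"
    using prime_ge_2_nat[OF p] \<open>k > 0\<close> self_le_power[of p k] unfolding q_def by linarith
  let ?P = "poly_ring L"
  interpret UP: domain ?P
    by (rule univ_poly_is_domain[OF carrier_is_subring])
  have X: "X \<in> carrier ?P" "degree X = 1"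
    using var_closed(1)[OF carrier_is_subring] by (auto simp: var_def)
  have Xq: "X [^]\<^bsub>?P\<^esub> q \<in> carrier ?P" "degree (X [^]\<^bsub>?P\<^esub> q) = q"
    using X polynomial_pow_degree[OF X(1), of q] by simp_all
  define f where "f = X [^]\<^bsub>?P\<^esub> q \<ominus>\<^bsub>?P\<^esub> X"
  have f: "f \<in> carrier ?P"
    using X Xq by (simp add: f_def)
  have deg: "degree f = q"
  proof -
    have "degree (\<ominus>\<^bsub>?P\<^esub> X) = 1"
      using univ_poly_a_inv_degree[OF carrier_is_subring X(1)] X by simp
    then show ?thesis
      using poly_add_degree_eq[OF carrier_is_subring, of "X [^]\<^bsub>?P\<^esub> q" "\<ominus>\<^bsub>?P\<^esub> X"]
        Xq X q UP.a_inv_closed[OF X(1)]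
      by (simp add: f_def a_minus_def univ_poly_carrier univ_poly_add)
  qed
  then have f0: "f \<noteq> []" using q by auto
  have root: "is_root f a \<longleftrightarrow> a \<in> carrier L \<and> a [^] q = a" for a
  proof (cases "a \<in> carrier L")
    case True
    interpret ev: ring_hom_ring ?P L "\<lambda>g. eval g a"
      by (rule eval_ring_hom[OF carrier_is_subring True])
    have "eval f a = a [^] q \<ominus> a"
      using X Xq True by (simp add: f_def a_minus_def eval_var ev.hom_nat_pow)
    then show ?thesis
      using True f0 by (simp add: is_root_def)
  qed (simp add: is_root_def)
  have const: "add_pow ?P p \<one>\<^bsub>?P\<^esub> = \<zero>\<^bsub>?P\<^esub>"
  proof -
    interpret c: ring_hom_ring L ?P poly_of_const
      using canonical_embedding_ring_hom[OF carrier_is_subring] by simp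
    have "poly_of_const (add_pow L n \<one>) = add_pow ?P n \<one>\<^bsub>?P\<^esub>" for n :: nat
      by (induction n) simp_all
    then show ?thesis
      using char by (metis c.hom_zero)
  qed
  have simple: "count (roots f) a \<le> 1" for a
  proof (rule ccontr)
    assume a2: "\<not> count (roots f) a \<le> 1"
    then have mult: "alg_mult f a \<ge> 2"
      by (simp add: alg_mult_eq_count_roots[OF f])
    have "a \<in># roots f"
      using a2 by (simp flip: count_greater_zero_iff)
    then have a: "a \<in> carrier L" "a [^] q = a"
      using root roots_mem_iff_is_root[OF f] by auto
    define c where "c = poly_of_const a"
    interpret c: ring_hom_ring L ?P poly_of_const
      using canonical_embedding_ring_hom[OF carrier_is_subring] by simp
    have c: "c \<in> carrier ?P" "c [^]\<^bsub>?P\<^esub> q = c"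
      using a c.hom_nat_pow[of a q] by (simp_all add: c_def)
    define g where "g = X \<ominus>\<^bsub>?P\<^esub> c"
    have g: "g \<in> carrier ?P"
      using X c by (simp add: g_def)
    have g_eq: "[\<one>, \<ominus> a] = g"
    proof -
      have "g = X \<oplus>\<^bsub>?P\<^esub> poly_of_const (\<ominus> a)"
        using a by (simp add: g_def c_def a_minus_def)
      then show ?thesis
        using a by (simp add: univ_poly_add var_def poly_of_const_def)
    qed
    have "g [^]\<^bsub>?P\<^esub> q = X [^]\<^bsub>?P\<^esub> q \<ominus>\<^bsub>?P\<^esub> c"
      using UP.frobenius_power_diff[OF p const X(1) c(1), of k] c(2)
      by (simp add: g_def q_def)
    then have f_eq: "f = g [^]\<^bsub>?P\<^esub> q \<ominus>\<^bsub>?P\<^esub> g"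
      using X Xq c unfolding f_def g_def
      by (simp add: a_minus_def UP.minus_add UP.a_assoc)
         (metis UP.a_ac UP.r_neg UP.a_inv_closed UP.r_zero)
    have "g [^]\<^bsub>?P\<^esub> (2::nat) pdivides f"
      using le_alg_mult_imp_pdivides[OF a(1) f mult] by (simp add: g_eq)
    moreover have "g [^]\<^bsub>?P\<^esub> (2::nat) pdivides g [^]\<^bsub>?P\<^esub> q"
      using polynomial_pow_division[OF g q] .
    ultimately obtain u v where uv: "u \<in> carrier ?P" "v \<in> carrier ?P"
        "f = g [^]\<^bsub>?P\<^esub> (2::nat) \<otimes>\<^bsub>?P\<^esub> u"
        "g [^]\<^bsub>?P\<^esub> q = g [^]\<^bsub>?P\<^esub> (2::nat) \<otimes>\<^bsub>?P\<^esub> v"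
      unfolding pdivides_def factor_def by blast
    have "g = g [^]\<^bsub>?P\<^esub> q \<ominus>\<^bsub>?P\<^esub> f"
      using g UP.nat_pow_closed[OF g, of q] unfolding f_eq
      by (simp add: a_minus_def UP.minus_add UP.r_neg2)
    also have "\<dots> = g [^]\<^bsub>?P\<^esub> (2::nat) \<otimes>\<^bsub>?P\<^esub> (v \<ominus>\<^bsub>?P\<^esub> u)"
      using uv g by (simp add: a_minus_def UP.r_distr UP.r_minus)
    finally have "g [^]\<^bsub>?P\<^esub> (2::nat) pdivides g"
      unfolding pdivides_def using uv by (intro dividesI) auto
    moreover have "degree (g [^]\<^bsub>?P\<^esub> (2::nat)) = 2" "degree g = 1" "g \<noteq> []"
      using polynomial_pow_degree[OF g, of 2] by (simp_all flip: g_eq)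
    ultimately show False
      using pdivides_imp_degree_le[OF carrier_is_subring _ g, of "g [^]\<^bsub>?P\<^esub> (2::nat)"] g by simp
  qed
  have "set_mset (roots f) = {x \<in> carrier L. x [^] q = x}"
    using root roots_mem_iff_is_root[OF f] by auto
  moreover have "size (roots f) = q"
    using roots_over_carrier[OF f] deg by (simp add: splitted_def)
  moreover have "size (roots f) = card (set_mset (roots f))"
  proof -
    have "size (roots f) = (\<Sum>a\<in>set_mset (roots f). count (roots f) a)"
      by (simp add: size_multiset_overloaded_eq)
    also have "\<dots> = (\<Sum>a\<in>set_mset (roots f). 1)"
      using simple by (intro sum.cong refl antisym) auto
    finally show ?thesis by simp
  qed
  ultimately show ?thesis by (simp add: q_def)
qed

lemma ex_finite_field_of_prime_power:
  assumes "primepow (q::nat)"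
  shows "\<exists>F :: ((int list \<times> nat) multiset \<Rightarrow> int) ring. field F \<and> card (carrier F) = q"
proof -
  obtain p k where p: "Factorial_Ring.prime p" and k: "k > 0" and q: "q = p ^ k"
    using assms by (auto simp: primepow_def)
  let ?Zp = "residue_ring (int p)"
  interpret Zp: residues_prime p ?Zp
    by unfold_locales (rule p)
  obtain L :: "((int list \<times> nat) multiset \<Rightarrow> int) ring"
    where L: "algebraic_closure L (Zp.indexed_const ` carrier ?Zp)"
      and hom: "Zp.indexed_const \<in> ring_hom ?Zp L"
    using Zp.exists_closure by blast
  interpret L: algebraic_closure L "Zp.indexed_const ` carrier ?Zp" by (rule L)
  interpret h: ring_hom_ring ?Zp L "Zp.indexed_const"
    by (rule ring_hom_ringI2) (use hom Zp.ring_axioms L.ring_axioms in auto)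
  have "add_pow ?Zp n \<one>\<^bsub>?Zp\<^esub> = int n mod int p" for n
    by (induction n) (simp_all add: Zp.res_zero_eq Zp.res_one_eq Zp.res_add_eq mod_add_right_eq add.commute)
  moreover have "Zp.indexed_const (add_pow ?Zp n \<one>\<^bsub>?Zp\<^esub>) = add_pow L n \<one>\<^bsub>L\<^esub>" for n :: nat
    by (induction n) simp_all
  ultimately have char: "add_pow L p \<one>\<^bsub>L\<^esub> = \<zero>\<^bsub>L\<^esub>"
    by (metis h.hom_zero Zp.res_zero_eq mod_self)
  let ?S = "{x \<in> carrier L. x [^]\<^bsub>L\<^esub> q = x}"
  have "field (L\<lparr>carrier := ?S\<rparr>)"
    using L.subfield_iff(2)[OF L.frobenius_fixed_points_subfield[OF p char]] by (simp add: q)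
  moreover have "card ?S = q"
    using L.card_frobenius_fixed_points[OF p char k] by (simp add: q)
  ultimately show ?thesis
    by (intro exI[of _ "L\<lparr>carrier := ?S\<rparr>"]) simp
qed

section \<open>Affine planes\<close>

text \<open>A plane of order \<open>q\<close> is recorded by its parallel classes, numbered from \<open>0\<close> to \<open>q\<close>: the value
  \<open>\<pi> i a\<close> is a name for the line of class \<open>i\<close> through the point \<open>a\<close>, so that the lines of class \<open>i\<close>
  are the fibres of \<open>\<pi> i\<close>.\<close>

definition affine_plane :: "nat \<Rightarrow> 'p set \<Rightarrow> (nat \<Rightarrow> 'p \<Rightarrow> 'c) \<Rightarrow> bool" where
  "affine_plane q P \<pi> \<longleftrightarrow>
     finite P \<and> card P = q\<^sup>2
     \<and> (\<forall>i\<le>q. \<forall>a\<in>P. card {b \<in> P. \<pi> i b = \<pi> i a} = q)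
     \<and> (\<forall>a\<in>P. \<forall>b\<in>P. \<exists>i\<le>q. \<pi> i a = \<pi> i b)"

text \<open>For \<open>i < q\<close> class \<open>i\<close> consists of the lines \<open>y + s i * x = c\<close>, where \<open>s\<close> enumerates the field and
  \<open>c\<close> serves as the name of the line; class \<open>q\<close> consists of the vertical lines.\<close>

lemma affine_plane_of_field:
  fixes F :: "('a, 'b) ring_scheme"
  assumes F: "field F" and card: "card (carrier F) = q" and q: "q > 0"
  shows "\<exists>(P :: ('a \<times> 'a) set) (\<pi> :: nat \<Rightarrow> 'a \<times> 'a \<Rightarrow> 'a). affine_plane q P \<pi>"
proof -
  interpret field F by (rule F)
  have fin: "finite (carrier F)" using card q by (simp add: card_ge_0_finite)
  obtain s where s: "bij_betw s {..<q} (carrier F)"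
    using ex_bij_betw_nat_finite[OF fin] card by (auto simp: atLeast0LessThan)
  have s_in: "s i \<in> carrier F" if "i < q" for i
    using s that by (auto simp: bij_betw_def)
  define P where "P = carrier F \<times> carrier F"
  define \<pi> where "\<pi> i = (\<lambda>(x, y). if i < q then y \<oplus>\<^bsub>F\<^esub> s i \<otimes>\<^bsub>F\<^esub> x else x)" for i
  have "card P = q\<^sup>2" "finite P"
    using card fin by (simp_all add: P_def card_cartesian_product power2_eq_square)
  moreover have "card {b \<in> P. \<pi> i b = \<pi> i a} = q" if "a \<in> P" for i a
  proof (cases "i < q")
    case True
    define c where "c = \<pi> i a"
    have c: "c \<in> carrier F"
      using that True by (auto simp: c_def \<pi>_def P_def s_in)
    have eq: "y \<oplus>\<^bsub>F\<^esub> s i \<otimes>\<^bsub>F\<^esub> x = c \<longleftrightarrow> y = c \<ominus>\<^bsub>F\<^esub> s i \<otimes>\<^bsub>F\<^esub> x"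
      if "x \<in> carrier F" "y \<in> carrier F" for x y
    proof -
      have m: "s i \<otimes>\<^bsub>F\<^esub> x \<in> carrier F" using that s_in[OF True] by simp
      show ?thesis
      proof
        assume "y \<oplus>\<^bsub>F\<^esub> s i \<otimes>\<^bsub>F\<^esub> x = c"
        then have "c \<ominus>\<^bsub>F\<^esub> s i \<otimes>\<^bsub>F\<^esub> x = (y \<oplus>\<^bsub>F\<^esub> s i \<otimes>\<^bsub>F\<^esub> x) \<ominus>\<^bsub>F\<^esub> s i \<otimes>\<^bsub>F\<^esub> x"
          by simp
        also have "\<dots> = y" using m that by (simp add: a_minus_def a_assoc r_neg)
        finally show "y = c \<ominus>\<^bsub>F\<^esub> s i \<otimes>\<^bsub>F\<^esub> x" by simp
      next
        assume "y = c \<ominus>\<^bsub>F\<^esub> s i \<otimes>\<^bsub>F\<^esub> x"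
        then show "y \<oplus>\<^bsub>F\<^esub> s i \<otimes>\<^bsub>F\<^esub> x = c"
          using m c by (simp add: a_minus_def a_assoc l_neg)
      qed
    qed
    have "{b \<in> P. \<pi> i b = c} = {b \<in> P. snd b = c \<ominus>\<^bsub>F\<^esub> s i \<otimes>\<^bsub>F\<^esub> fst b}"
    proof (intro Collect_cong conj_cong refl)
      fix b assume "b \<in> P"
      then show "\<pi> i b = c \<longleftrightarrow> snd b = c \<ominus>\<^bsub>F\<^esub> s i \<otimes>\<^bsub>F\<^esub> fst b"
        using eq[of "fst b" "snd b"] True by (auto simp: P_def \<pi>_def)
    qed
    also have "\<dots> = (\<lambda>x. (x, c \<ominus>\<^bsub>F\<^esub> s i \<otimes>\<^bsub>F\<^esub> x)) ` carrier F"
      using c s_in[OF True] True by (auto simp: P_def image_iff)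
    finally show ?thesis
      using card by (simp add: c_def card_image inj_on_def)
  next
    case False
    then have "{b \<in> P. \<pi> i b = \<pi> i a} = (\<lambda>y. (fst a, y)) ` carrier F"
      using that by (auto simp: P_def \<pi>_def)
    then show ?thesis
      using card by (simp add: card_image inj_on_def)
  qed
  moreover have "\<exists>i\<le>q. \<pi> i a = \<pi> i b" if aP: "a \<in> P" and bP: "b \<in> P" for a b
  proof (cases "fst a = fst b")
    case True
    then have "\<pi> q a = \<pi> q b" by (simp add: \<pi>_def split_beta)
    then show ?thesis by blast
  next
    case False
    obtain x y x' y' where ab: "a = (x, y)" "b = (x', y')"
      and car: "x \<in> carrier F" "y \<in> carrier F" "x' \<in> carrier F" "y' \<in> carrier F"
      using aP bP by (auto simp: P_def)
    define d where "d = x \<ominus>\<^bsub>F\<^esub> x'"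
    have d: "d \<in> carrier F" "d \<noteq> \<zero>\<^bsub>F\<^esub>" "d \<in> Units F"
      using False ab car by (auto simp: d_def field_Units)
    \<comment> \<open>\<open>t\<close> solves \<open>y + t * x = y' + t * x'\<close>, so the class with \<open>s i = t\<close> has a line through both points.\<close>
    define t where "t = (y' \<ominus>\<^bsub>F\<^esub> y) \<otimes>\<^bsub>F\<^esub> inv\<^bsub>F\<^esub> d"
    have t: "t \<in> carrier F" using d car by (simp add: t_def)
    then have "t \<in> s ` {..<q}"
      using s by (simp add: bij_betw_def)
    then obtain i where i: "i < q" "s i = t"
      by auto
    have "x = d \<oplus>\<^bsub>F\<^esub> x'"
      using car by (simp add: d_def a_minus_def a_assoc l_neg)
    then have "t \<otimes>\<^bsub>F\<^esub> x = t \<otimes>\<^bsub>F\<^esub> d \<oplus>\<^bsub>F\<^esub> t \<otimes>\<^bsub>F\<^esub> x'"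
      using t d car by (simp add: r_distr)
    moreover have "t \<otimes>\<^bsub>F\<^esub> d = y' \<ominus>\<^bsub>F\<^esub> y"
      using d car by (simp add: t_def m_assoc)
    ultimately have "y \<oplus>\<^bsub>F\<^esub> t \<otimes>\<^bsub>F\<^esub> x = (y \<oplus>\<^bsub>F\<^esub> (y' \<ominus>\<^bsub>F\<^esub> y)) \<oplus>\<^bsub>F\<^esub> t \<otimes>\<^bsub>F\<^esub> x'"
      using t car by (simp add: a_assoc)
    also have "y \<oplus>\<^bsub>F\<^esub> (y' \<ominus>\<^bsub>F\<^esub> y) = y'"
      using car by (simp add: a_minus_def a_lcomm r_neg)
    finally show ?thesis
      using i ab by (intro exI[of _ i]) (auto simp: \<pi>_def)
  qed
  ultimately show ?thesis unfolding affine_plane_def by blast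
qed

section \<open>Random maps spread the edges of a bounded-degree graph evenly\<close>

lemma card_eq_of_bool_sum:
  assumes "finite A"
  shows "real (card {x \<in> A. Q x}) = (\<Sum>x\<in>A. of_bool (Q x))"
  using assms by (simp add: Int_def)

text \<open>Read as a probability: a uniformly random map \<open>V \<rightarrow> P\<close> sends all of \<open>S\<close> into a set \<open>L\<close> of density
  \<open>1 / q\<close> with probability \<open>1 / q ^ card S\<close>.\<close>

lemma card_maps_into_subset:
  assumes "finite V" "finite P" "S \<subseteq> V" "L \<subseteq> P" "card L * q = card P"
  shows "card {f \<in> V \<rightarrow>\<^sub>E P. f ` S \<subseteq> L} * q ^ card S = card (V \<rightarrow>\<^sub>E P)"
proof -
  have "{f \<in> V \<rightarrow>\<^sub>E P. f ` S \<subseteq> L} = PiE V (\<lambda>v. if v \<in> S then L else P)"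
  proof (intro Set.equalityI subsetI)
    fix f assume "f \<in> PiE V (\<lambda>v. if v \<in> S then L else P)"
    then have f: "\<And>v. v \<in> V \<Longrightarrow> f v \<in> (if v \<in> S then L else P)"
      and ext: "f \<in> extensional V"
      by (auto simp: PiE_iff)
    have "f v \<in> P" if "v \<in> V" for v
      using f[OF that] assms(4) by (cases "v \<in> S") auto
    moreover have "f v \<in> L" if "v \<in> S" for v
      using f[of v] assms(3) that by auto
    ultimately show "f \<in> {f \<in> V \<rightarrow>\<^sub>E P. f ` S \<subseteq> L}"
      using ext by (auto simp: PiE_iff)
  qed (auto simp: PiE_iff)
  moreover have "q ^ card S = (\<Prod>v\<in>V. if v \<in> S then q else 1)"
    using assms by (simp add: prod.If_cases Int_absorb1)
  ultimately have "card {f \<in> V \<rightarrow>\<^sub>E P. f ` S \<subseteq> L} * q ^ card S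
      = (\<Prod>v\<in>V. card (if v \<in> S then L else P) * (if v \<in> S then q else 1))"
    using assms by (simp add: card_PiE prod.distrib)
  also have "\<dots> = (\<Prod>v\<in>V. card P)"
    using assms by (intro prod.cong) auto
  also have "\<dots> = card (V \<rightarrow>\<^sub>E P)"
    using assms by (simp add: card_PiE)
  finally show ?thesis .
qed

lemma card_intersecting_edges_le:
  assumes "finite V" "E \<subseteq> [V]\<^bsup>2\<^esup>" "\<And>v. v \<in> V \<Longrightarrow> card {e \<in> E. v \<in> e} \<le> D" "e \<in> E"
  shows "card {e' \<in> E. e \<inter> e' \<noteq> {}} \<le> 2 * D"
proof -
  have e: "e \<subseteq> V" "card e = 2" "finite e"
    using assms(2,4) by (auto simp: nsets_def)
  have "{e' \<in> E. e \<inter> e' \<noteq> {}} = (\<Union>v\<in>e. {e' \<in> E. v \<in> e'})" by blast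
  also have "card \<dots> \<le> (\<Sum>v\<in>e. card {e' \<in> E. v \<in> e'})"
    by (rule card_UN_le) (rule e)
  also have "\<dots> \<le> (\<Sum>v\<in>e. D)"
    using e assms(3) by (intro sum_mono) auto
  finally show ?thesis using e by simp
qed

text \<open>This is the bound \<open>2 * D * card E\<close> on the variance of the number \<open>cnt\<close> of edges sent into \<open>L\<close>,
  multiplied by the number of maps. In the second moment, a pair of disjoint edges contributes
  \<open>1 / q ^ 4\<close>, the square of the mean of one edge; a pair with a common vertex contributes at most \<open>1\<close>,
  and each edge meets at most \<open>2 * D\<close> edges, itself included.\<close>

lemma sum_squared_deviation_le:
  fixes E :: "'v set set" and P L :: "'p set" and q D :: nat
  assumes V: "finite V" and E: "E \<subseteq> [V]\<^bsup>2\<^esup>" and P: "finite P"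
    and L: "L \<subseteq> P" "card L * q = card P" and q: "q > 0"
    and deg: "\<And>v. v \<in> V \<Longrightarrow> card {e \<in> E. v \<in> e} \<le> D"
  shows "(\<Sum>f\<in>V \<rightarrow>\<^sub>E P. (real (card {e \<in> E. f ` e \<subseteq> L}) - card E / q\<^sup>2)\<^sup>2)
           \<le> card (V \<rightarrow>\<^sub>E P) * (2 * D * card E)"
proof -
  define \<Omega> where "\<Omega> = V \<rightarrow>\<^sub>E P"
  define N m where "N = real (card \<Omega>)" and "m = real (card E)"
  define avg where "avg = m / q\<^sup>2"
  have fin: "finite \<Omega>" unfolding \<Omega>_def using V P by (intro finite_PiE)
  have finE: "finite E" using finite_imp_finite_nsets[OF V] E finite_subset by blast
  define cnt where "cnt f = (\<Sum>e\<in>E. of_bool (f ` e \<subseteq> L) :: real)" for f :: "'v \<Rightarrow> 'p"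
  have cnt: "real (card {e \<in> E. f ` e \<subseteq> L}) = cnt f" for f
    unfolding cnt_def by (simp only: card_eq_of_bool_sum[OF finE])
  have into: "(\<Sum>f\<in>\<Omega>. of_bool (f ` S \<subseteq> L)) = N / q ^ card S" if "S \<subseteq> V" for S
  proof -
    have "real (card {f \<in> \<Omega>. f ` S \<subseteq> L}) * q ^ card S = N"
      using arg_cong[OF card_maps_into_subset[OF V P that L], of real]
      by (simp add: \<Omega>_def N_def)
    moreover have "(\<Sum>f\<in>\<Omega>. of_bool (f ` S \<subseteq> L)) = real (card {f \<in> \<Omega>. f ` S \<subseteq> L})"
      by (simp only: card_eq_of_bool_sum[OF fin])
    ultimately show ?thesis using q by (simp add: field_simps)
  qed
  have first: "(\<Sum>f\<in>\<Omega>. cnt f) = avg * N"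
  proof -
    have "(\<Sum>f\<in>\<Omega>. cnt f) = (\<Sum>e\<in>E. \<Sum>f\<in>\<Omega>. of_bool (f ` e \<subseteq> L))"
      unfolding cnt_def by (rule sum.swap)
    also have "\<dots> = (\<Sum>e\<in>E. N / q\<^sup>2)"
      using E by (intro sum.cong) (auto simp: into nsets_def)
    finally show ?thesis by (simp add: m_def avg_def)
  qed
  have second: "(\<Sum>f\<in>\<Omega>. (cnt f)\<^sup>2) \<le> avg\<^sup>2 * N + N * (2 * D * m)"
  proof -
    have pair: "(\<Sum>f\<in>\<Omega>. of_bool (f ` e \<subseteq> L) * of_bool (f ` e' \<subseteq> L))
                  \<le> N / q ^ 4 + N * of_bool (e \<inter> e' \<noteq> {})" if "e \<in> E" "e' \<in> E" for e e'
    proof -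
      have e: "e \<subseteq> V" "e' \<subseteq> V" "card e = 2" "card e' = 2" "finite e" "finite e'"
        using that E by (auto simp: nsets_def)
      have "(\<Sum>f\<in>\<Omega>. of_bool (f ` e \<subseteq> L) * of_bool (f ` e' \<subseteq> L))
              = (\<Sum>f\<in>\<Omega>. of_bool (f ` (e \<union> e') \<subseteq> L) :: real)"
        by (intro sum.cong) (auto simp: image_Un)
      also have "\<dots> = N / q ^ card (e \<union> e')"
        using e by (intro into) auto
      also have "\<dots> \<le> N / q ^ 4 + N * of_bool (e \<inter> e' \<noteq> {})"
      proof (cases "e \<inter> e' = {}")
        case True
        then have "card (e \<union> e') = 4" using e by (simp add: card_Un_disjoint)
        then show ?thesis by (simp add: N_def)
      next
        case False
        have "N / q ^ card (e \<union> e') \<le> N / 1"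
          using q by (intro divide_left_mono) (auto simp: N_def)
        moreover have "0 \<le> N / q ^ 4" by (simp add: N_def)
        ultimately show ?thesis using False by simp
      qed
      finally show ?thesis .
    qed
    have "(\<Sum>f\<in>\<Omega>. (cnt f)\<^sup>2)
            = (\<Sum>f\<in>\<Omega>. \<Sum>e\<in>E. \<Sum>e'\<in>E. of_bool (f ` e \<subseteq> L) * of_bool (f ` e' \<subseteq> L))"
      unfolding cnt_def power2_eq_square sum_product ..
    also have "\<dots> = (\<Sum>e\<in>E. \<Sum>f\<in>\<Omega>. \<Sum>e'\<in>E. of_bool (f ` e \<subseteq> L) * of_bool (f ` e' \<subseteq> L))"
      by (rule sum.swap)
    also have "\<dots> = (\<Sum>e\<in>E. \<Sum>e'\<in>E. \<Sum>f\<in>\<Omega>. of_bool (f ` e \<subseteq> L) * of_bool (f ` e' \<subseteq> L))"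
      by (rule sum.cong[OF refl sum.swap])
    also have "\<dots> \<le> (\<Sum>e\<in>E. \<Sum>e'\<in>E. N / q ^ 4 + N * of_bool (e \<inter> e' \<noteq> {}))"
      by (intro sum_mono pair)
    also have "\<dots> = (\<Sum>e\<in>E. m * N / q ^ 4 + N * real (card {e' \<in> E. e \<inter> e' \<noteq> {}}))"
      unfolding card_eq_of_bool_sum[OF finE] sum_distrib_left sum.distrib by (simp add: m_def)
    also have "\<dots> \<le> (\<Sum>e\<in>E. m * N / q ^ 4 + N * real (2 * D))"
      using card_intersecting_edges_le[OF V E deg]
      by (intro sum_mono add_left_mono mult_left_mono) (auto simp: N_def simp flip: of_nat_mult)
    also have "\<dots> = m * (m * N / q ^ 4 + N * real (2 * D))"
      by (simp add: m_def)
    also have "\<dots> = avg\<^sup>2 * N + N * (2 * D * m)"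
      by (simp add: avg_def power_divide distrib_left power2_eq_square[of m] flip: power_mult)
    finally show ?thesis .
  qed
  have "(\<Sum>f\<in>\<Omega>. (cnt f - avg)\<^sup>2) = (\<Sum>f\<in>\<Omega>. (cnt f)\<^sup>2 - 2 * avg * cnt f + avg\<^sup>2)"
    by (intro sum.cong refl) (simp add: power2_eq_square algebra_simps)
  also have "\<dots> = (\<Sum>f\<in>\<Omega>. (cnt f)\<^sup>2) - 2 * avg * (\<Sum>f\<in>\<Omega>. cnt f) + N * avg\<^sup>2"
    by (simp add: sum.distrib sum_subtractf N_def sum_distrib_left)
  also have "\<dots> = (\<Sum>f\<in>\<Omega>. (cnt f)\<^sup>2) - avg\<^sup>2 * N"
    by (simp add: first power2_eq_square)
  also have "\<dots> \<le> N * (2 * D * m)"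
    using second by linarith
  finally show ?thesis
    by (simp add: cnt \<Omega>_def N_def m_def avg_def)
qed

text \<open>Averaging the sum of the squared deviations over all sets in \<open>\<L>\<close> gives one map that works for all
  of them at once.\<close>

lemma ex_balanced_map:
  fixes E :: "'v set set" and P :: "'p set" and q D :: nat
  assumes V: "finite V" and E: "E \<subseteq> [V]\<^bsup>2\<^esup>" and P: "finite P" "P \<noteq> {}"
    and \<L>: "finite \<L>" "\<And>L. L \<in> \<L> \<Longrightarrow> L \<subseteq> P \<and> card L * q = card P" and q: "q > 0"
    and deg: "\<And>v. v \<in> V \<Longrightarrow> card {e \<in> E. v \<in> e} \<le> D"
  shows "\<exists>f \<in> V \<rightarrow> P. \<forall>L\<in>\<L>. real (card {e \<in> E. f ` e \<subseteq> L})
           \<le> card E / q\<^sup>2 + sqrt (card \<L> * (2 * D * card E))"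
proof -
  define B where "B = real (card \<L> * (2 * D * card E))"
  define dev where "dev f L = (real (card {e \<in> E. f ` e \<subseteq> L}) - card E / q\<^sup>2)\<^sup>2"
    for f :: "'v \<Rightarrow> 'p" and L
  have fin: "finite (V \<rightarrow>\<^sub>E P)" and ne: "V \<rightarrow>\<^sub>E P \<noteq> {}"
    using V P by (auto intro: finite_PiE simp: PiE_eq_empty_iff)
  have "\<exists>f \<in> V \<rightarrow>\<^sub>E P. (\<Sum>L\<in>\<L>. dev f L) \<le> B"
  proof (rule ccontr)
    assume "\<not> ?thesis"
    then have "(\<Sum>f\<in>V \<rightarrow>\<^sub>E P. B) < (\<Sum>f\<in>V \<rightarrow>\<^sub>E P. \<Sum>L\<in>\<L>. dev f L)"
      using fin ne by (intro sum_strict_mono) auto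
    also have "\<dots> = (\<Sum>L\<in>\<L>. \<Sum>f\<in>V \<rightarrow>\<^sub>E P. dev f L)"
      by (rule sum.swap)
    also have "\<dots> \<le> (\<Sum>L\<in>\<L>. real (card (V \<rightarrow>\<^sub>E P)) * (2 * D * card E))"
      unfolding dev_def using \<L>(2)
      by (intro sum_mono sum_squared_deviation_le[OF V E P(1) _ _ q deg, THEN order_trans]) auto
    finally show False by (simp add: B_def)
  qed
  then obtain f where f: "f \<in> V \<rightarrow>\<^sub>E P" "(\<Sum>L\<in>\<L>. dev f L) \<le> B" by blast
  have "real (card {e \<in> E. f ` e \<subseteq> L}) \<le> card E / q\<^sup>2 + sqrt B" if "L \<in> \<L>" for L
  proof -
    have "dev f L \<le> (\<Sum>L\<in>\<L>. dev f L)"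
      using that \<L>(1) by (intro member_le_sum) (auto simp: dev_def)
    with f(2) have "dev f L \<le> B" by simp
    then show ?thesis
      using real_le_rsqrt[of "real (card {e \<in> E. f ` e \<subseteq> L}) - card E / q\<^sup>2" B]
      by (simp add: dev_def)
  qed
  then show ?thesis
    using f(1) by (intro bexI[of _ f]) (auto simp: B_def)
qed

section \<open>Colouring a graph by an affine plane\<close>

lemma high_degree_count:
  assumes V: "finite V" and E: "E \<subseteq> [V]\<^bsup>2\<^esup>"
  shows "D * card {v \<in> V. D \<le> card {e \<in> E. v \<in> e}} \<le> 2 * card E"
proof -
  define H where "H = {v \<in> V. D \<le> card {e \<in> E. v \<in> e}}"
  have finH: "finite H" using V by (simp add: H_def)
  have finE: "finite E" using finite_imp_finite_nsets[OF V] E finite_subset by blast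
  have "D * card H = (\<Sum>v\<in>H. D)" by simp
  also have "\<dots> \<le> (\<Sum>v\<in>H. card {e \<in> E. v \<in> e})"
    by (intro sum_mono) (simp add: H_def)
  also have "\<dots> = (\<Sum>e\<in>E. card {v \<in> H. v \<in> e})"
    unfolding card_eq_sum by (rule sum.swap_restrict[OF finH finE])
  also have "\<dots> \<le> (\<Sum>e\<in>E. 2)"
  proof (rule sum_mono)
    fix e assume "e \<in> E"
    then have e: "finite e" "card e = 2" using E by (auto simp: nsets_def)
    have "{v \<in> H. v \<in> e} \<subseteq> e" by blast
    then show "card {v \<in> H. v \<in> e} \<le> 2" using card_mono[OF e(1)] e(2) by metis
  qed
  finally show ?thesis by (simp add: H_def)
qed

lemma path_vertex_cover_bound:
  assumes inj: "inj_on g {..<n}" and H: "finite H"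
    and cover: "\<And>j. Suc j < n \<Longrightarrow> g j \<in> H \<or> g (Suc j) \<in> H"
  shows "n div 2 \<le> card H"
proof -
  \<comment> \<open>The edges between \<open>g (2 * k)\<close> and \<open>g (2 * k + 1)\<close> are disjoint; each contributes a vertex of \<open>H\<close>.\<close>
  define idx where "idx k = (if g (2 * k) \<in> H then 2 * k else Suc (2 * k))" for k
  have idx: "idx k < n" "g (idx k) \<in> H" "idx k div 2 = k" if "k < n div 2" for k
    using that cover[of "2 * k"] by (auto simp: idx_def)
  have "inj_on (\<lambda>k. g (idx k)) {..<n div 2}"
  proof (rule inj_onI)
    fix k l assume kl: "k \<in> {..<n div 2}" "l \<in> {..<n div 2}" "g (idx k) = g (idx l)"
    then have "idx k = idx l" using inj idx by (auto dest: inj_onD)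
    then show "k = l" using idx kl by (metis lessThan_iff)
  qed
  then have "card {..<n div 2} \<le> card H"
    by (rule card_inj_on_le) (use idx H in auto)
  then show ?thesis by simp
qed

lemma path_edges_card:
  assumes inj: "inj_on g {..<n}" and F: "finite F"
    and edge: "\<And>j. Suc j < n \<Longrightarrow> {g j, g (Suc j)} \<in> F"
  shows "n - 1 \<le> card F"
proof -
  have "inj_on (\<lambda>j. {g j, g (Suc j)}) {..<n - 1}"
  proof (rule inj_onI)
    fix j k assume jk: "j \<in> {..<n - 1}" "k \<in> {..<n - 1}" "{g j, g (Suc j)} = {g k, g (Suc k)}"
    then have "g j = g k \<or> (g j = g (Suc k) \<and> g (Suc j) = g k)"
      by (auto simp: doubleton_eq_iff)
    moreover have "j < n" "k < n" "Suc j < n" "Suc k < n" using jk by auto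
    ultimately have "j = k \<or> (j = Suc k \<and> Suc j = k)"
      using inj by (auto simp: inj_on_eq_iff)
    then show "j = k" by auto
  qed
  then have "card {..<n - 1} \<le> card F"
    by (rule card_inj_on_le) (use edge F in auto)
  then show ?thesis by simp
qed

text \<open>The colouring: edges meeting \<open>H\<close> get colour \<open>q + 1\<close>, every other edge gets a parallel class with a
  line through the images of both its ends. In the colour \<open>q + 1\<close> the set \<open>H\<close> covers all edges of the
  path; in any other colour \<open>i\<close>, consecutive vertices of the path have images on the same line of
  class \<open>i\<close>, hence all of them do.\<close>

lemma affine_colouring:
  fixes G :: "'v graph" and \<pi> :: "nat \<Rightarrow> 'p \<Rightarrow> 'c"
  assumes G: "finite_simple_graph G" and plane: "affine_plane q P \<pi>"
    and f: "f \<in> verts G \<rightarrow> P" and arr: "arrows G (path_graph n) (q + 2)" and n: "n \<ge> 2"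
  shows "n div 2 \<le> card (H \<inter> verts G) \<or>
    (\<exists>i\<le>q. \<exists>a\<in>P. n - 1 \<le> card {e \<in> edges G. e \<inter> H = {} \<and> f ` e \<subseteq> {b \<in> P. \<pi> i b = \<pi> i a}})"
proof -
  define par where "par e i \<longleftrightarrow> i \<le> q \<and> (\<forall>u\<in>e. \<forall>v\<in>e. \<pi> i (f u) = \<pi> i (f v))" for e i
  define c where "c e = (if e \<inter> H = {} then SOME i. par e i else Suc q)" for e
  have finV: "finite (verts G)" and E: "edges G \<subseteq> [verts G]\<^bsup>2\<^esup>"
    using G by (auto simp: finite_simple_graph_def)
  have finE: "finite (edges G)"
    using finite_imp_finite_nsets[OF finV] E finite_subset by blast
  have par: "par e (SOME i. par e i)" if e: "e \<in> edges G" for e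
  proof -
    obtain u v where uv: "e = {u, v}" "u \<in> verts G" "v \<in> verts G"
      using e E by (auto simp: nsets_def card_2_iff)
    then obtain i where "i \<le> q" "\<pi> i (f u) = \<pi> i (f v)"
      using plane f unfolding affine_plane_def by blast
    then have "par e i" by (auto simp: par_def uv)
    then show ?thesis by (rule someI)
  qed
  have "c \<in> edges G \<rightarrow> {..<q + 2}"
    using par by (force simp: c_def par_def)
  then obtain i where i: "i < q + 2" "contains_copy (colour_class G c i) (path_graph n)"
    using arr unfolding arrows_def by blast
  then obtain g where g: "inj_on g {..<n}" "g ` {..<n} \<subseteq> verts G"
      and copy: "\<forall>e \<in> edges (path_graph n). g ` e \<in> edges (colour_class G c i)"
    unfolding contains_copy_def by (auto simp: path_graph_def colour_class_def)
  have mono: "{g j, g (Suc j)} \<in> edges G \<and> c {g j, g (Suc j)} = i" if "Suc j < n" for j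
  proof -
    have "{j, Suc j} \<in> edges (path_graph n)"
      using that by (auto simp: path_graph_def)
    with copy have "g ` {j, Suc j} \<in> edges (colour_class G c i)" by blast
    then show ?thesis by (simp add: colour_class_def)
  qed
  show ?thesis
  proof (cases "i = Suc q")
    case True
    have "g j \<in> H \<inter> verts G \<or> g (Suc j) \<in> H \<inter> verts G" if j: "Suc j < n" for j
    proof -
      have "{g j, g (Suc j)} \<inter> H \<noteq> {}"
        using mono[OF j] par[of "{g j, g (Suc j)}"] True
        by (auto simp: c_def par_def split: if_splits)
      moreover have "g j \<in> verts G" "g (Suc j) \<in> verts G"
        using g(2) j by auto
      ultimately show ?thesis by blast
    qed
    then have "n div 2 \<le> card (H \<inter> verts G)"
      using path_vertex_cover_bound[OF g(1)] finV by simp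
    then show ?thesis ..
  next
    case False
    then have iq: "i \<le> q" using i(1) by simp
    have edge: "{g j, g (Suc j)} \<in> edges G" "{g j, g (Suc j)} \<inter> H = {}"
      and step: "\<pi> i (f (g (Suc j))) = \<pi> i (f (g j))" if j: "Suc j < n" for j
    proof -
      show "{g j, g (Suc j)} \<in> edges G" using mono[OF j] by blast
      show H: "{g j, g (Suc j)} \<inter> H = {}"
        using mono[OF j] False by (auto simp: c_def split: if_splits)
      have "par {g j, g (Suc j)} i"
        using par[of "{g j, g (Suc j)}"] mono[OF j] H unfolding c_def by simp
      then show "\<pi> i (f (g (Suc j))) = \<pi> i (f (g j))" unfolding par_def by blast
    qed
    have line: "\<pi> i (f (g j)) = \<pi> i (f (g 0))" if "j < n" for j
      using that by (induction j) (simp_all add: step)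
    have inP: "f (g j) \<in> P" if "j < n" for j
      using that g(2) f by auto
    have "n - 1 \<le> card {e \<in> edges G. e \<inter> H = {} \<and> f ` e \<subseteq> {b \<in> P. \<pi> i b = \<pi> i (f (g 0))}}"
    proof (rule path_edges_card[OF g(1)])
      fix j assume j: "Suc j < n"
      then have "f ` {g j, g (Suc j)} \<subseteq> {b \<in> P. \<pi> i b = \<pi> i (f (g 0))}"
        using line[of j] line[of "Suc j"] inP[of j] inP[of "Suc j"] by auto
      then show "{g j, g (Suc j)} \<in> {e \<in> edges G. e \<inter> H = {} \<and> f ` e \<subseteq> {b \<in> P. \<pi> i b = \<pi> i (f (g 0))}}"
        using edge[OF j] by blast
    qed (use finE in simp)
    moreover have "f (g 0) \<in> P" using inP n by simp
    ultimately show ?thesis using iq by blast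
  qed
qed

text \<open>The degree threshold \<open>D = 6 * q\<^sup>2\<close> makes the vertices of degree at least \<open>D\<close> too few to cover a
  path: \<open>D * (n div 2) \<ge> 2 * q\<^sup>2 * n\<close>, while the degrees sum to less than that. The first square root in
  the bound comes from \<open>ex_balanced_map\<close>: there are at most \<open>(q + 1) * q\<^sup>2\<close> lines, and
  \<open>2 * D * m \<le> 12 * q ^ 4 * n\<close>. The added \<open>2\<close> turns \<open>n - 1 \<le> n - 2 * sqrt n\<close> into a contradiction.\<close>

lemma path_arrows_many_edges:
  fixes G :: "'v graph" and \<pi> :: "nat \<Rightarrow> 'p \<Rightarrow> 'c"
  assumes plane: "affine_plane q P \<pi>" and q: "q > 0" and G: "finite_simple_graph G"
    and arr: "arrows G (path_graph n) (q + 2)" and n: "n \<ge> 2"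
  shows "real (card (edges G))
           > q\<^sup>2 * n - q\<^sup>2 * (sqrt (12 * (q + 1) * q ^ 6) + 2) * sqrt n"
proof (rule ccontr)
  define K where "K = sqrt (12 * (q + 1) * q ^ 6)"
  define m where "m = real (card (edges G))"
  define D where "D = 6 * q\<^sup>2"
  define H where "H = {v \<in> verts G. D \<le> card {e \<in> edges G. v \<in> e}}"
  define E' where "E' = {e \<in> edges G. e \<inter> H = {}}"
  define \<L> where "\<L> = (\<Union>i\<le>q. (\<lambda>a. {b \<in> P. \<pi> i b = \<pi> i a}) ` P)"
  assume "\<not> ?thesis"
  then have m_le: "m \<le> q\<^sup>2 * n - q\<^sup>2 * (K + 2) * sqrt n"
    by (simp add: m_def K_def not_less algebra_simps)
  have K: "K \<ge> 0" by (simp add: K_def)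
  have "real (q\<^sup>2) * (K + 2) * sqrt n > 0"
    using q n K by (intro mult_pos_pos) auto
  then have m_less: "m < real (q\<^sup>2) * n" using m_le by simp
  have finV: "finite (verts G)" and E: "edges G \<subseteq> [verts G]\<^bsup>2\<^esup>"
    using G by (auto simp: finite_simple_graph_def)
  have finE: "finite (edges G)"
    using finite_imp_finite_nsets[OF finV] E finite_subset by blast
  have E': "E' \<subseteq> edges G" by (auto simp: E'_def)
  have deg: "card {e \<in> E'. v \<in> e} \<le> D" if "v \<in> verts G" for v
  proof (cases "v \<in> H")
    case True
    then have none: "{e \<in> E'. v \<in> e} = {}" by (auto simp: E'_def)
    show ?thesis unfolding none by simp
  next
    case False
    have "card {e \<in> E'. v \<in> e} \<le> card {e \<in> edges G. v \<in> e}"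
      using finE E' by (intro card_mono) auto
    then show ?thesis using False that by (simp add: H_def)
  qed
  have P: "finite P" "card P = q\<^sup>2" using plane by (auto simp: affine_plane_def)
  have lines: "L \<subseteq> P \<and> card L * q = card P" if "L \<in> \<L>" for L
    using that plane by (auto simp: \<L>_def affine_plane_def power2_eq_square)
  have "card \<L> \<le> (\<Sum>i\<le>q. card ((\<lambda>a. {b \<in> P. \<pi> i b = \<pi> i a}) ` P))"
    unfolding \<L>_def by (rule card_UN_le) simp
  also have "\<dots> \<le> (\<Sum>i\<le>q. q\<^sup>2)"
    unfolding P(2)[symmetric] by (intro sum_mono card_image_le P(1))
  finally have card_lines: "card \<L> \<le> (q + 1) * q\<^sup>2" by simp
  have "\<exists>f \<in> verts G \<rightarrow> P. \<forall>L\<in>\<L>. real (card {e \<in> E'. f ` e \<subseteq> L})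
           \<le> card E' / q\<^sup>2 + sqrt (card \<L> * (2 * D * card E'))"
  proof (rule ex_balanced_map[OF finV _ P(1) _ _ lines q deg])
    show "E' \<subseteq> [verts G]\<^bsup>2\<^esup>" using E E' by blast
    show "P \<noteq> {}" using P q by auto
    show "finite \<L>" using P by (auto simp: \<L>_def)
  qed
  then obtain f where f: "f \<in> verts G \<rightarrow> P"
    and bal: "\<And>L. L \<in> \<L> \<Longrightarrow> real (card {e \<in> E'. f ` e \<subseteq> L})
           \<le> card E' / q\<^sup>2 + sqrt (card \<L> * (2 * D * card E'))"
    by blast
  from affine_colouring[OF G plane f arr n, of H] show False
  proof (elim disjE exE bexE conjE)
    assume "n div 2 \<le> card (H \<inter> verts G)"
    then have "n div 2 \<le> card H" by (simp add: H_def Int_def conj_commute)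
    then have "D * (n div 2) \<le> D * card H" by simp
    also have "\<dots> \<le> 2 * card (edges G)"
      unfolding H_def by (rule high_degree_count[OF finV E])
    finally have "real (D * (n div 2)) \<le> 2 * m"
      unfolding m_def by (metis of_nat_le_iff of_nat_mult of_nat_numeral)
    moreover have "3 * (n div 2) \<ge> n" using n by linarith
    then have "2 * q\<^sup>2 * n \<le> 2 * q\<^sup>2 * (3 * (n div 2))" by (rule mult_le_mono2)
    then have "2 * q\<^sup>2 * n \<le> D * (n div 2)"
      unfolding D_def by (simp only: mult_ac)
    then have "real (2 * q\<^sup>2 * n) \<le> real (D * (n div 2))"
      by (rule of_nat_mono)
    ultimately show False using m_less by simp
  next
    fix i a assume ia: "i \<le> q" "a \<in> P"
      and path: "n - 1 \<le> card {e \<in> edges G. e \<inter> H = {} \<and> f ` e \<subseteq> {b \<in> P. \<pi> i b = \<pi> i a}}"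
    define L where "L = {b \<in> P. \<pi> i b = \<pi> i a}"
    have "L \<in> \<L>" using ia by (auto simp: L_def \<L>_def)
    note bal[OF this]
    moreover have "n - 1 \<le> card {e \<in> E'. f ` e \<subseteq> L}"
      using path by (simp add: E'_def L_def conj_assoc)
    moreover have E'm: "real (card E') \<le> m"
      unfolding m_def using finE E' by (simp add: card_mono)
    have "real (card E') / q\<^sup>2 \<le> n - (K + 2) * sqrt n"
    proof -
      have "real (card E') \<le> real (q\<^sup>2) * (n - (K + 2) * sqrt n)"
        using E'm m_le by (simp add: algebra_simps)
      then show ?thesis using q by (simp add: field_simps)
    qed
    moreover have "sqrt (card \<L> * (2 * D * card E')) \<le> K * sqrt n"
    proof -
      have "real (card \<L> * (2 * D * card E'))
              \<le> real ((q + 1) * q\<^sup>2) * (real (2 * D) * (real (q\<^sup>2) * n))"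
        using card_lines E'm m_less unfolding of_nat_mult[of "card \<L>"] of_nat_mult[of "2 * D"]
        by (intro mult_mono of_nat_mono) auto
      also have "\<dots> = 12 * (q + 1) * q ^ 6 * n"
        by (simp add: D_def algebra_simps power2_eq_square eval_nat_numeral)
      finally show ?thesis
        unfolding K_def by (simp flip: real_sqrt_mult)
    qed
    ultimately have "real (n - 1) \<le> n - 2 * sqrt n"
      by (simp add: algebra_simps)
    moreover have "sqrt n \<ge> 1" using n by simp
    ultimately show False using n by simp
  qed
qed

theorem theorem8:
  fixes r :: nat
  assumes "r \<ge> 3"
    and "r - 2 = 1 \<or> primepow (r - 2)"
  shows "\<exists>C::real. \<forall>\<^sub>F n in sequentially.
           real (size_ramsey (path_graph n) r) > (real r - 2)^2 * real n - C * sqrt (real n)"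
proof -
  define q where "q = r - 2"
  have q: "q > 0" "r = q + 2" using assms(1) by (auto simp: q_def)
  define C where "C = q\<^sup>2 * (sqrt (12 * (q + 1) * q ^ 6) + 2)"
  have many: "real (card (edges G)) > q\<^sup>2 * n - C * sqrt n"
    if "finite_simple_graph G" "arrows G (path_graph n) r" "n \<ge> 2" for G :: "nat graph" and n
  proof -
    have arr: "arrows G (path_graph n) (q + 2)" using that(2) q(2) by simp
    show ?thesis
    proof (cases "q = 1")
      case True
      have "affine_plane q {()} (\<lambda>_ _. ())"
        unfolding affine_plane_def True by auto
      from path_arrows_many_edges[OF this q(1) that(1) arr that(3)] show ?thesis
        by (simp add: C_def add_ac)
    next
      case False
      then have "primepow q" using assms(2) by (simp add: q_def)
      then obtain F :: "((int list \<times> nat) multiset \<Rightarrow> int) ring"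
        where F: "field F" "card (carrier F) = q"
        using ex_finite_field_of_prime_power by blast
      from affine_plane_of_field[OF F q(1)] show ?thesis
        by (elim exE)
          (drule path_arrows_many_edges[OF _ q(1) that(1) arr that(3)], simp add: C_def add_ac)
    qed
  qed
  have "real (size_ramsey (path_graph n) r) > (real r - 2)^2 * real n - C * sqrt (real n)"
    if n: "n \<ge> 2" for n
  proof -
    have "\<exists>m. \<exists>G :: nat graph. finite_simple_graph G \<and> arrows G (path_graph n) r \<and> card (edges G) = m"
      using ex_arrows[OF finite_simple_path_graph] by blast
    from LeastI_ex[OF this] obtain G :: "nat graph" where
      "finite_simple_graph G" "arrows G (path_graph n) r"
      "card (edges G) = size_ramsey (path_graph n) r"
      unfolding size_ramsey_def by blast
    then show ?thesis
      using many[of G n] n q(2) by simp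
  qed
  then show ?thesis
    unfolding eventually_sequentially by blast
qed

end
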